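(* Let $G$ be a connected noncomplete graph of order $n\geq 9$. If $\delta(G)\geq n/4$, then $pc(G)=2$.
   Context: All graphs are finite, simple and undirected; $\delta(G)$ is the minimum degree. In an edge-colored graph, a path is a proper path if no two adjacent (consecutive) edges of the path receive the same color. For a connected graph $G$, the proper connection number $pc(G)$ is the minimum number of colors in an edge-coloring of $G$ (adjacent edges may share colors) such that every pair of distinct vertices of $G$ is joined by at least one proper path. *)

theory Defs
  imports Complex_Main "Graph_Theory.Graph_Theory"
begin

text \<open>
  Finite simple undirected graphs are represented by the locale predicate \<^const>\<open>graph\<close>:
  finite loop-free symmetric digraphs without parallel arcs. An undirected edge
  between \<open>u\<close> and \<open>v\<close> corresponds to the two arcs from \<open>u\<close> to \<open>v\<close> and from \<open>v\<close> to \<open>u\<close>,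
  so the degree of a vertex is its \<^const>\<open>out_degree\<close>.
\<close>

definition min_degree :: "('a, 'b) pre_digraph \<Rightarrow> nat" where
  "min_degree G = Min (out_degree G ` verts G)"

definition edges :: "('a, 'b) pre_digraph \<Rightarrow> 'a set set" where
  "edges G = {{u, v} |u v. (u, v) \<in> arcs_ends G}"

text \<open>
  An edge-coloring assigns colors to unordered pairs; only its values on \<^const>\<open>edges\<close> matter.
  Taking natural numbers as colors is no restriction since the graphs are finite.
\<close>

definition proper_path ::
  "('a, 'b) pre_digraph \<Rightarrow> ('a set \<Rightarrow> nat) \<Rightarrow> 'a list \<Rightarrow> bool" where
  "proper_path G c p \<longleftrightarrow> vpath p G \<and>
     (\<forall>i. i + 2 < length p \<longrightarrow> c {p ! i, p ! (i + 1)} \<noteq> c {p ! (i + 1), p ! (i + 2)})"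

definition proper_connected :: "('a, 'b) pre_digraph \<Rightarrow> ('a set \<Rightarrow> nat) \<Rightarrow> bool" where
  "proper_connected G c \<longleftrightarrow>
     (\<forall>u \<in> verts G. \<forall>v \<in> verts G. u \<noteq> v \<longrightarrow>
        (\<exists>p. proper_path G c p \<and> hd p = u \<and> last p = v))"

text \<open>Meaningful for connected graphs only: a disconnected graph has no such coloring.\<close>

definition proper_connection_number :: "('a, 'b) pre_digraph \<Rightarrow> nat" where
  "proper_connection_number G =
     (LEAST k. \<exists>c. proper_connected G c \<and> card (c ` edges G) = k)"

end

theory Submission
  imports Defs
begin

text \<open>
  Orient the edges of a bipartite graph with parts \<open>A\<close>, \<open>B\<close> and give the arcs from \<open>A\<close> to \<open>B\<close> one
  color and the arcs from \<open>B\<close> to \<open>A\<close> the other: then directed paths are proper. So it suffices to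
  find a spanning bipartite subgraph with a unilateral orientation, that is, one in which any two
  vertices are joined by a directed path in one of the two directions. By an ear argument in the
  style of Robbins' theorem, a connected graph has such an orientation unless it has three disjoint
  vertex sets each of which is left by a single edge.

  A maximum cut keeps at least half of the edges leaving any vertex set, so a set left by a single
  cut edge is left by at most two edges of \<open>G\<close> and has more than \<open>\<delta> \<ge> n/4\<close> vertices. Three disjoint
  such sets leave room for a single further vertex \<open>x\<close> only, and one of them, \<open>L\<close>, has two edges to
  \<open>x\<close>. As \<open>L\<close> is dense, the cut can be changed inside \<open>L\<close> so that \<open>L \<union> {x}\<close> becomes
  2-edge-connected, after which no three such sets remain.
\<close>

section \<open>Unilateral orientations\<close>

text \<open>Undirected graphs are symmetric relations here. Keeping only the outward copy of each
  crossing edge makes the cardinality count undirected edges.\<close>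

definition edge_cut :: "'a rel \<Rightarrow> 'a set \<Rightarrow> 'a rel" where
  "edge_cut E X = E \<inter> X \<times> - X"

text \<open>Admitting an empty cut makes the whole vertex set thin, which starts the minimality
  argument in \<open>unilateral_orientation\<close>.\<close>

definition thin :: "'a rel \<Rightarrow> 'a set \<Rightarrow> bool" where
  "thin E X \<longleftrightarrow> X \<noteq> {} \<and> card (edge_cut E X) \<le> 1"

text \<open>\<open>D\<close> orients a selection of the edges inside \<open>C\<close>; asymmetry
  keeps an edge from being used in both directions.\<close>

definition strong_orientation :: "'a rel \<Rightarrow> 'a set \<Rightarrow> 'a rel \<Rightarrow> bool" where
  "strong_orientation E C D \<longleftrightarrow>
     D \<subseteq> E \<inter> C \<times> C \<and> asym D \<and> (\<forall>u\<in>C. \<forall>v\<in>C. (u, v) \<in> D\<^sup>*)"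

text \<open>For \<open>v\<close> outside \<open>C\<close> this is the connected component of
  \<open>v\<close> after deletion of \<open>C\<close>.\<close>

definition outer_component :: "'a rel \<Rightarrow> 'a set \<Rightarrow> 'a \<Rightarrow> 'a set" where
  "outer_component E C v = (E \<inter> (- C) \<times> (- C))\<^sup>* `` {v}"

lemma finite_edge_cut: "finite E \<Longrightarrow> finite (edge_cut E X)"
  by (simp add: edge_cut_def)

lemma edge_cut_Compl: "sym E \<Longrightarrow> edge_cut E (- X) = (edge_cut E X)\<inverse>"
  by (auto simp: edge_cut_def dest: symD)

lemma card_edge_cut_Compl: "sym E \<Longrightarrow> card (edge_cut E (- X)) = card (edge_cut E X)"
  by (simp add: edge_cut_Compl)

lemma edge_cut_Diff:
  assumes "E \<subseteq> V \<times> V"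
  shows "edge_cut E (V - X) = edge_cut E (- X)"
  using assms by (auto simp: edge_cut_def)

section \<open>Enlarging a strongly oriented vertex set by ears\<close>

text \<open>Keep the arcs along which the distance to \<open>y\<close> drops by one. They contain a
  shortest path from every vertex that reaches \<open>y\<close>, and a distance cannot drop in both
  directions.\<close>

lemma rtrancl_shortest_path_forest:
  obtains P where "P \<subseteq> K" "asym P" "\<And>z. (z, y) \<in> K\<^sup>* \<Longrightarrow> (z, y) \<in> P\<^sup>*"
proof -
  \<comment> \<open>If \<open>z\<close> cannot reach \<open>y\<close>, the value \<open>d z\<close>
    is unspecified; this is harmless, since asymmetry of \<open>P\<close> only compares
    numbers.\<close>
  define d where "d z = (LEAST k. (z, y) \<in> K ^^ k)" for z
  define P where "P = {(s, t) \<in> K. d s = Suc (d t)}"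
  have d: "(z, y) \<in> K ^^ d z" if "(z, y) \<in> K\<^sup>*" for z
    using that unfolding d_def rtrancl_power by (metis LeastI_ex)
  have d_le: "d z \<le> k" if "(z, y) \<in> K ^^ k" for z k
    unfolding d_def using that by (rule Least_le)
  have "(z, y) \<in> P\<^sup>*" if "(z, y) \<in> K\<^sup>*" for z
    using that
  proof (induction "d z" arbitrary: z)
    case 0
    then show ?case using d[of z] by simp
  next
    case (Suc k)
    then have "(z, y) \<in> K ^^ Suc k" using d[of z] by simp
    then obtain t where t: "(z, t) \<in> K" "(t, y) \<in> K ^^ k"
      by (meson relpow_Suc_D2)
    have ty: "(t, y) \<in> K\<^sup>*" using t(2) by (auto simp: rtrancl_power)
    have "(z, y) \<in> K ^^ Suc (d t)" using t(1) d[OF ty] by (rule relpow_Suc_I2)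
    then have dt: "d t = k" using d_le[of z] d_le[OF t(2)] Suc.hyps(2) by fastforce
    then have "(t, y) \<in> P\<^sup>*" using Suc.hyps(1) ty by blast
    moreover have "(z, t) \<in> P" using t(1) dt Suc.hyps(2) by (simp add: P_def)
    ultimately show ?case by (rule converse_rtrancl_into_rtrancl[rotated])
  qed
  moreover have "P \<subseteq> K" by (auto simp: P_def)
  moreover have "asym P" by (rule asymI) (auto simp: P_def)
  ultimately show ?thesis using that by blast
qed

text \<open>A generalized ear: enter the outer component through \<open>(u, v)\<close>, follow
  shortest paths to \<open>y\<close>, return through \<open>(y, w)\<close>. Condition
  \<open>ne\<close> prevents a single edge from serving as both entrance and exit.\<close>

lemma strong_orientation_add_ear:
  assumes "sym E" "strong_orientation E C D"
    and u: "u \<in> C" "(u, v) \<in> E" "v \<notin> C"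
    and w: "w \<in> C" "(y, w) \<in> E" and vy: "y \<in> outer_component E C v"
    and ne: "(v, u) \<noteq> (y, w)"
  obtains C' D' where "C \<subset> C'" "C' \<subseteq> C \<union> Range E" "strong_orientation E C' D'"
proof -
  define K where "K = E \<inter> (- C) \<times> (- C)"
  have symK: "sym K" using \<open>sym E\<close> by (auto simp: K_def sym_def)
  have vyK: "(v, y) \<in> K\<^sup>*" using vy by (simp add: outer_component_def K_def)
  obtain P where P: "P \<subseteq> K" "asym P" "\<And>z. (z, y) \<in> K\<^sup>* \<Longrightarrow> (z, y) \<in> P\<^sup>*"
    by (rule rtrancl_shortest_path_forest[of K y]) blast
  \<comment> \<open>\<open>F\<close> is closed under arcs of \<open>P\<close>, so each of its
    vertices is reached from \<open>v\<close> and still reaches \<open>y\<close> inside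
    \<open>F\<close>.\<close>
  define F where "F = P\<^sup>* `` {v}"
  define Q where "Q = P \<inter> F \<times> F"
  define C' where "C' = C \<union> F"
  define D' where "D' = insert (u, v) (insert (y, w) (D \<union> Q))"
  have D: "D \<subseteq> E \<inter> C \<times> C" "asym D" and reachD: "\<And>s t. s \<in> C \<Longrightarrow> t \<in> C \<Longrightarrow> (s, t) \<in> D\<^sup>*"
    using assms(2) by (auto simp: strong_orientation_def)
  have vyP: "(v, y) \<in> P\<^sup>*" using vyK P(3) by blast
  have vF: "v \<in> F" by (simp add: F_def)
  have yF: "y \<in> F" using vyP by (simp add: F_def)
  have K_out: "z \<notin> C" if "(v, z) \<in> K\<^sup>*" for z
    using that by (induction) (auto simp: K_def u(3))
  have F_K: "(v, z) \<in> K\<^sup>*" if "z \<in> F" for z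
    using that rtrancl_mono[OF P(1)] by (auto simp: F_def)
  have F_out: "z \<notin> C" if "z \<in> F" for z
    using K_out F_K that by blast
  have reachQ1: "(v, z) \<in> Q\<^sup>*" if "z \<in> F" for z
  proof -
    have "(v, z) \<in> P\<^sup>*" using that by (simp add: F_def)
    then show ?thesis
    proof induction
      case (step s t)
      then have "(s, t) \<in> Q" by (auto simp: Q_def F_def intro: rtrancl_into_rtrancl)
      with step.IH show ?case by (rule rtrancl_into_rtrancl)
    qed simp
  qed
  have reachQ2: "(z, y) \<in> Q\<^sup>*" if "z \<in> F" for z
  proof -
    have "(z, v) \<in> K\<^sup>*" using F_K[OF that] sym_rtrancl[OF symK] by (meson symD)
    then have "(z, y) \<in> P\<^sup>*" using vyK P(3) by (meson rtrancl_trans)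
    then show ?thesis using that
    proof (induction rule: converse_rtrancl_induct)
      case (step s t)
      have "t \<in> F" using step by (auto simp: F_def intro: rtrancl_into_rtrancl)
      with step show ?case by (auto simp: Q_def intro: converse_rtrancl_into_rtrancl)
    qed simp
  qed
  have sub: "Q\<^sup>* \<subseteq> D'\<^sup>*" "D\<^sup>* \<subseteq> D'\<^sup>*"
    by (auto simp: D'_def intro!: rtrancl_mono)
  have uv: "(u, v) \<in> D'" and yw: "(y, w) \<in> D'" by (auto simp: D'_def)
  have from_u: "(u, z) \<in> D'\<^sup>*" if "z \<in> C'" for z
  proof (cases "z \<in> C")
    case True then show ?thesis using reachD[OF u(1)] sub by blast
  next
    case False
    then have "(v, z) \<in> D'\<^sup>*" using that reachQ1 sub by (auto simp: C'_def)
    then show ?thesis using uv by (rule converse_rtrancl_into_rtrancl[rotated])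
  qed
  have to_u: "(z, u) \<in> D'\<^sup>*" if "z \<in> C'" for z
  proof (cases "z \<in> C")
    case True then show ?thesis using reachD[OF _ u(1)] sub by blast
  next
    case False
    then have "(z, y) \<in> D'\<^sup>*" using that reachQ2 sub by (auto simp: C'_def)
    moreover have "(w, u) \<in> D'\<^sup>*" using reachD[OF w(1) u(1)] sub by blast
    ultimately show ?thesis using yw by (meson rtrancl.rtrancl_into_rtrancl rtrancl_trans)
  qed
  have "asym D'"
  proof (rule asymI)
    fix s t assume "(s, t) \<in> D'"
    moreover have "asym Q" using P(2) by (auto simp: Q_def asym_iff)
    ultimately show "(t, s) \<notin> D'"
      using D ne F_out vF yF u w by (auto simp: D'_def Q_def dest: asymD)
  qed
  moreover have "D' \<subseteq> E \<inter> C' \<times> C'"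
    using D(1) P(1) u w vF yF by (auto simp: D'_def C'_def Q_def K_def)
  ultimately have "strong_orientation E C' D'"
    unfolding strong_orientation_def using from_u to_u by (meson rtrancl_trans)
  moreover have "C \<subset> C'" using vF u(3) by (auto simp: C'_def)
  moreover have "F \<subseteq> Range E"
  proof
    fix z assume "z \<in> F"
    then have "(v, z) \<in> K\<^sup>*" by (rule F_K)
    then show "z \<in> Range E" using u(2) by (cases rule: rtranclE) (auto simp: K_def)
  qed
  then have "C' \<subseteq> C \<union> Range E" by (auto simp: C'_def)
  ultimately show ?thesis using that by blast
qed

lemma outer_component_props:
  assumes "v \<notin> C"
  shows "v \<in> outer_component E C v" "outer_component E C v \<inter> C = {}"
proof -
  show "v \<in> outer_component E C v" by (simp add: outer_component_def)
  have "z \<notin> C" if "(v, z) \<in> (E \<inter> (- C) \<times> (- C))\<^sup>*" for z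
    using that by induction (auto simp: assms)
  then show "outer_component E C v \<inter> C = {}" by (auto simp: outer_component_def)
qed

lemma outer_component_step:
  assumes "v \<notin> C" "s \<in> outer_component E C v" "(s, t) \<in> E" "t \<notin> C"
  shows "t \<in> outer_component E C v"
proof -
  have "s \<notin> C" using outer_component_props(2)[OF assms(1), of E] assms(2) by blast
  then show ?thesis using assms by (auto simp: outer_component_def intro: rtrancl_into_rtrancl)
qed

lemma outer_component_subset:
  assumes "E \<subseteq> V \<times> V" "v \<in> V"
  shows "outer_component E C v \<subseteq> V"
proof
  fix z assume "z \<in> outer_component E C v"
  then have "(v, z) \<in> (E \<inter> (- C) \<times> (- C))\<^sup>*" by (simp add: outer_component_def)
  then show "z \<in> V" using assms by (cases rule: rtranclE) auto
qed

lemma outer_component_reach: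
  assumes "z \<in> outer_component E C v"
  shows "(v, z) \<in> (E \<inter> outer_component E C v \<times> outer_component E C v)\<^sup>*"
proof -
  have "(v, z) \<in> (E \<inter> (- C) \<times> (- C))\<^sup>*" using assms by (simp add: outer_component_def)
  then show ?thesis
  proof induction
    case (step s t)
    then have "(s, t) \<in> E \<inter> outer_component E C v \<times> outer_component E C v"
      by (auto simp: outer_component_def intro: rtrancl_into_rtrancl)
    with step.IH show ?case by (rule rtrancl_into_rtrancl)
  qed simp
qed

lemma outer_component_eq:
  assumes "sym E" "z \<in> outer_component E C v" "z \<in> outer_component E C v'"
  shows "outer_component E C v = outer_component E C v'"
proof -
  let ?K = "E \<inter> (- C) \<times> (- C)"
  have "sym (?K\<^sup>*)" by (rule sym_rtrancl) (use assms(1) in \<open>auto simp: sym_def\<close>)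
  then show ?thesis
    using assms(2,3) unfolding outer_component_def Image_singleton_iff
    by (auto) (meson rtrancl_trans symD)+
qed

text \<open>Take \<open>C\<close> of maximum size. A second edge leaving an outer component would be
  the return edge of an ear and enlarge \<open>C\<close>, so every outer component hangs on
  \<open>C\<close> by a bridge.\<close>

lemma maximal_strong_orientation:
  assumes "finite V" "E \<subseteq> V \<times> V" "sym E" "r \<in> V"
  obtains C D where "r \<in> C" "C \<subseteq> V" "strong_orientation E C D"
    and "\<And>u v. u \<in> C \<Longrightarrow> (u, v) \<in> E \<Longrightarrow> v \<notin> C \<Longrightarrow>
      edge_cut E (outer_component E C v) = {(v, u)}"
proof -
  let ?P = "\<lambda>C. r \<in> C \<and> C \<subseteq> V \<and> (\<exists>D. strong_orientation E C D)"
  have "?P {r}" using assms(4) by (auto simp: strong_orientation_def asym_iff intro!: exI[of _ "{}"])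
  moreover have "\<forall>C. ?P C \<longrightarrow> card C < Suc (card V)"
    using card_mono[OF assms(1)] by (simp add: less_Suc_eq_le)
  ultimately have "\<exists>C. ?P C \<and> (\<forall>C'. ?P C' \<longrightarrow> card C' \<le> card C)"
    by (rule ex_has_greatest_nat)
  then obtain C where C: "?P C" and max: "\<And>C'. ?P C' \<Longrightarrow> card C' \<le> card C"
    by metis
  then obtain D where D: "strong_orientation E C D" by blast
  have "edge_cut E (outer_component E C v) = {(v, u)}"
    if uv: "u \<in> C" "(u, v) \<in> E" "v \<notin> C" for u v
  proof
    let ?F = "outer_component E C v"
    show "{(v, u)} \<subseteq> edge_cut E ?F"
      using uv outer_component_props[OF uv(3)] assms(3) by (auto simp: edge_cut_def dest: symD)
    show "edge_cut E ?F \<subseteq> {(v, u)}"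
    proof (rule ccontr)
      assume "\<not> ?thesis"
      then obtain y w where yw: "y \<in> ?F" "w \<notin> ?F" "(y, w) \<in> E" "(v, u) \<noteq> (y, w)"
        by (auto simp: edge_cut_def)
      then have "w \<in> C" using outer_component_step[OF uv(3)] by blast
      then obtain C' D' where "C \<subset> C'" "C' \<subseteq> C \<union> Range E" "strong_orientation E C' D'"
        using strong_orientation_add_ear[OF assms(3) D uv _ yw(3,1,4)] by blast
      moreover from this have C'V: "C' \<subseteq> V" using C assms(2) by auto
      ultimately have "?P C'" using C by blast
      then have "card C' \<le> card C" by (rule max)
      moreover have "card C < card C'"
        using \<open>C \<subset> C'\<close> C'V assms(1) by (meson finite_subset psubset_card_mono)
      ultimately show False by simp
    qed
  qed
  then show ?thesis using that C D by blast
qed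

section \<open>Thin sets as the obstruction to unilateral orientations\<close>

text \<open>If \<open>C\<close> met both \<open>X\<close> and its complement, directed walks would
  leave and enter \<open>X\<close>. By asymmetry they use two different edges, too many for a thin
  set.\<close>

lemma strong_orientation_thin:
  assumes "finite E" "sym E" "strong_orientation E C D" "thin E X" "r \<in> C" "r \<notin> X"
  shows "X \<inter> C = {}"
proof (rule ccontr)
  have D: "D \<subseteq> E" "asym D" and reach: "\<And>s t. s \<in> C \<Longrightarrow> t \<in> C \<Longrightarrow> (s, t) \<in> D\<^sup>*"
    using assms(3) by (auto simp: strong_orientation_def)
  assume "X \<inter> C \<noteq> {}"
  then obtain z where z: "z \<in> X" "z \<in> C" by blast
  have cross: "\<exists>s t. (s, t) \<in> D \<and> s \<in> Y \<and> t \<notin> Y" if "(p, q) \<in> D\<^sup>*" "p \<in> Y" "q \<notin> Y" for p q Y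
    using that by (induction rule: rtrancl_induct) auto
  obtain s t where st: "(s, t) \<in> D" "s \<in> X" "t \<notin> X"
    using cross[OF reach[OF z(2) assms(5)], of X] z assms(6) by blast
  obtain s' t' where st': "(s', t') \<in> D" "s' \<notin> X" "t' \<in> X"
    using cross[OF reach[OF assms(5) z(2)], of "- X"] z assms(6) by blast
  have "(s, t) \<noteq> (t', s')" using st(1) st'(1) D(2) by (auto dest: asymD)
  moreover have "{(s, t), (t', s')} \<subseteq> edge_cut E X"
    using st st' D(1) assms(2) by (auto simp: edge_cut_def dest: symD)
  ultimately have "2 \<le> card (edge_cut E X)"
    using card_mono[OF finite_edge_cut[OF assms(1)], of "{(s, t), (t', s')}" X] by auto
  then show False using assms(4) by (simp add: thin_def)
qed

text \<open>The maximal strong set containing the root has a single exit, which is a bridge; recurse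
  on its far side.\<close>

lemma rooted_unilateral_orientation:
  assumes "finite V" "E \<subseteq> V \<times> V" "sym E" "r \<in> V" "V \<subseteq> E\<^sup>* `` {r}"
    and "\<And>X Y. thin E X \<Longrightarrow> thin E Y \<Longrightarrow> X \<subseteq> V - {r} \<Longrightarrow> Y \<subseteq> V - {r} \<Longrightarrow> X \<inter> Y \<noteq> {}"
  shows "\<exists>D\<subseteq>E. asym D \<and> (\<forall>v\<in>V. (r, v) \<in> D\<^sup>*) \<and>
    (\<forall>u\<in>V. \<forall>v\<in>V. (u, v) \<in> D\<^sup>* \<or> (v, u) \<in> D\<^sup>*)"
  using assms
proof (induction "card V" arbitrary: V E r rule: less_induct)
  case less
  note fin = less.prems(1) and EV = less.prems(2) and symE = less.prems(3)
    and r = less.prems(4) and conn = less.prems(5) and nothin = less.prems(6)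
  obtain C D where C: "r \<in> C" "C \<subseteq> V" "strong_orientation E C D"
    and exit: "\<And>u v. u \<in> C \<Longrightarrow> (u, v) \<in> E \<Longrightarrow> v \<notin> C \<Longrightarrow>
      edge_cut E (outer_component E C v) = {(v, u)}"
    using maximal_strong_orientation[OF fin EV symE r] by blast
  have D: "D \<subseteq> E \<inter> C \<times> C" "asym D" and reach: "\<And>s t. s \<in> C \<Longrightarrow> t \<in> C \<Longrightarrow> (s, t) \<in> D\<^sup>*"
    using C(3) by (auto simp: strong_orientation_def)
  show ?case
  proof (cases "\<exists>u v. u \<in> C \<and> (u, v) \<in> E \<and> v \<notin> C")
    case False
    have "v \<in> C" if "(r, v) \<in> E\<^sup>*" for v
      using that by induction (use C(1) False in auto)
    then have "C = V" using conn C(2) by auto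
    then show ?thesis using D reach r by (intro exI[of _ D]) auto
  next
    case True
    then obtain u v where uv: "u \<in> C" "(u, v) \<in> E" "v \<notin> C" by blast
    define F where "F = outer_component E C v"
    have F: "v \<in> F" "F \<inter> C = {}" "F \<subseteq> V" "edge_cut E F = {(v, u)}"
      unfolding F_def using outer_component_props[OF uv(3)] exit[OF uv]
        outer_component_subset[OF EV, of v C] uv(2) EV by blast+
    \<comment> \<open>Outer components are thin and miss the root, so any two of them coincide, and
      each has only one edge to leave by.\<close>
    have unique: "(s, t) = (u, v)" if st: "s \<in> C" "(s, t) \<in> E" "t \<notin> C" for s t
    proof -
      let ?F' = "outer_component E C t"
      have F': "t \<in> ?F'" "?F' \<inter> C = {}" "?F' \<subseteq> V" "edge_cut E ?F' = {(t, s)}"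
        using outer_component_props[OF st(3)] exit[OF st]
          outer_component_subset[OF EV, of t C] st(2) EV by blast+
      have "thin E F" "thin E ?F'" using F F' by (auto simp: thin_def)
      moreover have "F \<subseteq> V - {r}" "?F' \<subseteq> V - {r}" using F F' C(1) by auto
      ultimately have "F \<inter> ?F' \<noteq> {}" using nothin by blast
      then have "F = ?F'" unfolding F_def using outer_component_eq[OF symE] by blast
      then show ?thesis using F(4) F'(4) by auto
    qed
    have VF: "V = C \<union> F"
    proof -
      have "z \<in> C \<union> F" if "(r, z) \<in> E\<^sup>*" for z
        using that
      proof induction
        case (step s t)
        then show ?case
          using unique[of s t] F(1) outer_component_step[OF uv(3), of s E t] by (auto simp: F_def)
      qed (use C(1) in simp)
      then show ?thesis using conn C(2) F(3) by auto
    qed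
    let ?E = "E \<inter> F \<times> F"
    \<comment> \<open>The only edge leaving \<open>F\<close> starts at \<open>v\<close>, so a subset
      of \<open>F\<close> without \<open>v\<close> keeps its cut. This hands the hypothesis on thin
      sets to the recursion rooted at \<open>v\<close>.\<close>
    have cutF: "edge_cut ?E X = edge_cut E X" if "X \<subseteq> F - {v}" for X
      using that F(4) by (auto simp: edge_cut_def)
    have "\<exists>D'\<subseteq>?E. asym D' \<and> (\<forall>z\<in>F. (v, z) \<in> D'\<^sup>*) \<and>
        (\<forall>s\<in>F. \<forall>t\<in>F. (s, t) \<in> D'\<^sup>* \<or> (t, s) \<in> D'\<^sup>*)"
    proof (rule less.hyps)
      show "card F < card V"
        using F C(1) r fin by (intro psubset_card_mono) auto
      show "finite F" using F(3) fin by (rule finite_subset)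
      show "sym ?E" using symE by (auto simp: sym_def)
      show "F \<subseteq> ?E\<^sup>* `` {v}" using outer_component_reach[of _ E C v] by (auto simp: F_def)
      show "X \<inter> Y \<noteq> {}" if "thin ?E X" "thin ?E Y" "X \<subseteq> F - {v}" "Y \<subseteq> F - {v}" for X Y
        using that cutF[of X] cutF[of Y] F C(1) by (intro nothin) (auto simp: thin_def)
    qed (use F in auto)
    then obtain D' where D': "D' \<subseteq> ?E" "asym D'" "\<And>z. z \<in> F \<Longrightarrow> (v, z) \<in> D'\<^sup>*"
      "\<And>s t. s \<in> F \<Longrightarrow> t \<in> F \<Longrightarrow> (s, t) \<in> D'\<^sup>* \<or> (t, s) \<in> D'\<^sup>*" by blast
    \<comment> \<open>The bridge is directed away from the root: all of \<open>C\<close> reaches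
      \<open>u\<close>, and \<open>v\<close> reaches all of \<open>F\<close>.\<close>
    define D'' where "D'' = insert (u, v) (D \<union> D')"
    have sub: "D\<^sup>* \<subseteq> D''\<^sup>*" "D'\<^sup>* \<subseteq> D''\<^sup>*" by (auto simp: D''_def intro!: rtrancl_mono)
    have down: "(s, t) \<in> D''\<^sup>*" if "s \<in> C" "t \<in> F" for s t
    proof -
      have "(s, u) \<in> D''\<^sup>*" "(v, t) \<in> D''\<^sup>*" using reach[OF that(1) uv(1)] D'(3)[OF that(2)] sub by auto
      moreover have "(u, v) \<in> D''" by (simp add: D''_def)
      ultimately show ?thesis by (meson rtrancl.rtrancl_into_rtrancl rtrancl_trans)
    qed
    have "D'' \<subseteq> E" using D D' uv by (auto simp: D''_def)
    moreover have "asym D''"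
      using D D' uv F by (auto simp: D''_def asym_iff)
    moreover have "(r, z) \<in> D''\<^sup>*" if "z \<in> V" for z
      using that down[OF C(1)] reach[OF C(1)] sub by (auto simp: VF)
    moreover have "(s, t) \<in> D''\<^sup>* \<or> (t, s) \<in> D''\<^sup>*" if "s \<in> V" "t \<in> V" for s t
      using that down reach D'(4) sub unfolding VF by blast
    ultimately show ?thesis by blast
  qed
qed

text \<open>Root the orientation inside a smallest thin set. The maximal strong set around that root
  is itself thin, so two disjoint thin sets missing the root would form a forbidden triple with
  it.\<close>

lemma unilateral_orientation:
  assumes "finite V" "V \<noteq> {}" "E \<subseteq> V \<times> V" "sym E"
    and conn: "\<And>X. X \<subseteq> V \<Longrightarrow> X \<noteq> {} \<Longrightarrow> X \<noteq> V \<Longrightarrow> edge_cut E X \<noteq> {}"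
    and nothin: "\<And>X Y Z. thin E X \<Longrightarrow> thin E Y \<Longrightarrow> thin E Z \<Longrightarrow> X \<union> Y \<union> Z \<subseteq> V \<Longrightarrow>
      X \<inter> Y = {} \<Longrightarrow> X \<inter> Z = {} \<Longrightarrow> Y \<inter> Z = {} \<Longrightarrow> False"
  obtains D where "D \<subseteq> E" "asym D" "\<And>u v. u \<in> V \<Longrightarrow> v \<in> V \<Longrightarrow> (u, v) \<in> D\<^sup>* \<or> (v, u) \<in> D\<^sup>*"
proof -
  have finE: "finite E" using assms(1,3) by (meson finite_SigmaI finite_subset)
  have "edge_cut E V = {}" using assms(3) by (auto simp: edge_cut_def)
  then have "thin E V" using assms(2) by (simp add: thin_def)
  then obtain X where X: "thin E X" "X \<subseteq> V"
    and minX: "\<And>Y. thin E Y \<Longrightarrow> Y \<subseteq> V \<Longrightarrow> card X \<le> card Y"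
    using ex_has_least_nat[of "\<lambda>X. thin E X \<and> X \<subseteq> V" V card] by auto
  then obtain r where r: "r \<in> X" by (auto simp: thin_def)
  then have rV: "r \<in> V" using X by auto
  obtain C D where C: "r \<in> C" "C \<subseteq> V" "strong_orientation E C D"
    and exit: "\<And>u v. u \<in> C \<Longrightarrow> (u, v) \<in> E \<Longrightarrow> v \<notin> C \<Longrightarrow>
      edge_cut E (outer_component E C v) = {(v, u)}"
    using maximal_strong_orientation[OF assms(1,3,4) rV] by blast
  have thin_compl: "thin E (- X)" if "X \<noteq> UNIV"
    using X(1) that card_edge_cut_Compl[OF assms(4), of X] by (auto simp: thin_def)
  \<comment> \<open>Unless \<open>X\<close> is everything, \<open>- X\<close> is thin too and misses
    \<open>r\<close>, hence misses all of \<open>C\<close>.\<close>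
  have CX: "C \<subseteq> X"
  proof (cases "X = UNIV")
    case False
    then show ?thesis using strong_orientation_thin[OF finE assms(4) C(3) thin_compl C(1)] r by blast
  qed simp
  \<comment> \<open>Otherwise the outer component, being connected, could not leave
    \<open>X\<close>; it is thin and lacks \<open>r\<close>, so it would be a smaller thin
    set.\<close>
  have not_sub: "\<exists>s t. (s, t) \<in> edge_cut E X \<and> t \<in> outer_component E C v"
    if uv: "u \<in> C" "(u, v) \<in> E" "v \<notin> C" for u v
  proof (rule ccontr)
    let ?F = "outer_component E C v"
    have F: "v \<in> ?F" "?F \<inter> C = {}" "?F \<subseteq> V"
      using outer_component_props[OF uv(3)] outer_component_subset[OF assms(3), of v C] uv(2) assms(3) by blast+
    assume "\<not> ?thesis"
    then have step: "t \<in> X" if "s \<in> X" "(s, t) \<in> E" "t \<in> ?F" for s t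
      using that by (auto simp: edge_cut_def)
    have vX: "v \<in> X" using step[of u v] uv F CX by auto
    have "z \<in> X" if "z \<in> ?F" for z
    proof -
      have "(v, z) \<in> (E \<inter> ?F \<times> ?F)\<^sup>*" using that by (rule outer_component_reach)
      then show ?thesis by induction (use vX step in auto)
    qed
    then have "?F \<subset> X" using F r C(1) by auto
    then have "card ?F < card X"
      using X(2) assms(1) by (meson finite_subset psubset_card_mono)
    moreover have "thin E ?F" using F exit[OF uv] by (auto simp: thin_def)
    ultimately show False using minX[of ?F] F by simp
  qed
  \<comment> \<open>Only one edge leaves \<open>X\<close>, so all outer components contain its far
    end and are the same one.\<close>
  have unique: "(u, v) = (u', v')"
    if uv: "u \<in> C" "(u, v) \<in> E" "v \<notin> C" and uv': "u' \<in> C" "(u', v') \<in> E" "v' \<notin> C" for u v u' v'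
  proof -
    obtain s t where st: "(s, t) \<in> edge_cut E X" "t \<in> outer_component E C v"
      using not_sub[OF uv] by blast
    obtain s' t' where st': "(s', t') \<in> edge_cut E X" "t' \<in> outer_component E C v'"
      using not_sub[OF uv'] by blast
    have "(s, t) = (s', t')"
      using X(1) st(1) st'(1) finite_edge_cut[OF finE, of X]
      by (metis One_nat_def card_le_Suc0_iff_eq thin_def)
    then have "outer_component E C v = outer_component E C v'"
      using outer_component_eq[OF assms(4)] st(2) st'(2) by blast
    then have "{(v, u)} = {(v', u')}" using exit[OF uv] exit[OF uv'] by argo
    then show ?thesis by simp
  qed
  have thinC: "thin E C"
  proof -
    have "x = y" if "x \<in> edge_cut E C" "y \<in> edge_cut E C" for x y
      using that unique[of "fst x" "snd x" "fst y" "snd y"]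
      by (simp add: edge_cut_def mem_Times_iff prod_eq_iff)
    then show ?thesis
      using C(1) finite_edge_cut[OF finE, of C] by (auto simp: thin_def card_le_Suc0_iff_eq)
  qed
  have "\<exists>D\<subseteq>E. asym D \<and> (\<forall>v\<in>V. (r, v) \<in> D\<^sup>*) \<and>
    (\<forall>u\<in>V. \<forall>v\<in>V. (u, v) \<in> D\<^sup>* \<or> (v, u) \<in> D\<^sup>*)"
  proof (rule rooted_unilateral_orientation[OF assms(1,3,4) rV])
    show "V \<subseteq> E\<^sup>* `` {r}"
    proof (rule ccontr)
      assume "\<not> ?thesis"
      then have "V \<inter> E\<^sup>* `` {r} \<noteq> V" "V \<inter> E\<^sup>* `` {r} \<noteq> {}" using rV by auto
      then have "edge_cut E (V \<inter> E\<^sup>* `` {r}) \<noteq> {}" using conn by auto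
      then show False using assms(3) by (auto simp: edge_cut_def intro: rtrancl_into_rtrancl)
    qed
    show "P \<inter> Q \<noteq> {}" if "thin E P" "thin E Q" "P \<subseteq> V - {r}" "Q \<subseteq> V - {r}" for P Q
      using nothin[OF that(1,2) thinC] that C(2)
        strong_orientation_thin[OF finE assms(4) C(3) that(1) C(1)]
        strong_orientation_thin[OF finE assms(4) C(3) that(2) C(1)] by blast
  qed
  then show ?thesis using that by blast
qed

section \<open>Maximum cuts\<close>

text \<open>The spanning bipartite subgraph with sides \<open>A\<close> and \<open>- A\<close>.
  Unlike \<open>edge_cut\<close> it is symmetric, so each edge counts twice.\<close>

definition cut_graph :: "'a rel \<Rightarrow> 'a set \<Rightarrow> 'a rel" where
  "cut_graph E A = {(u, v) \<in> E. (u \<in> A) \<noteq> (v \<in> A)}"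

lemma sym_cut_graph: "sym E \<Longrightarrow> sym (cut_graph E A)"
  by (auto simp: cut_graph_def sym_def)

lemma cut_graph_subset: "cut_graph E A \<subseteq> E"
  by (auto simp: cut_graph_def)

lemma card_cut_graph:
  assumes "finite E" "sym E"
  shows "card (cut_graph E X) = 2 * card (edge_cut E X)"
proof -
  have "cut_graph E X = edge_cut E X \<union> (edge_cut E X)\<inverse>"
    using assms(2) by (auto simp: cut_graph_def edge_cut_def sym_def)
  moreover have "edge_cut E X \<inter> (edge_cut E X)\<inverse> = {}" by (auto simp: edge_cut_def)
  ultimately show ?thesis
    using finite_edge_cut[OF assms(1), of X] by (simp add: card_Un_disjoint)
qed

text \<open>Moving \<open>X\<close> to the other side exchanges cut and uncut edges among those
  leaving \<open>X\<close> and affects no others. Only this one move is assumed not to gain, because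
  a later cut is maximum merely within a restricted class.\<close>

lemma edge_cut_le_twice_if_flip_le:
  assumes "finite E" "sym E"
    and le: "card (cut_graph E ((A - X) \<union> (X - A))) \<le> card (cut_graph E A)"
  shows "card (edge_cut E X) \<le> 2 * card (edge_cut (cut_graph E A) X)"
proof -
  let ?HA = "cut_graph E A" and ?HX = "cut_graph E X"
  have fin: "finite ?HA" "finite ?HX"
    using assms(1) cut_graph_subset by (metis finite_subset)+
  \<comment> \<open>Cuts add modulo 2: a symmetric difference of sides gives the symmetric
    difference of the cut graphs.\<close>
  have "cut_graph E ((A - X) \<union> (X - A)) = (?HA - ?HX) \<union> (?HX - ?HA)"
    by (auto simp: cut_graph_def)
  moreover have "card ((?HA - ?HX) \<union> (?HX - ?HA)) = card (?HA - ?HX) + card (?HX - ?HA)"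
    using fin by (intro card_Un_disjoint) auto
  ultimately have "card (?HA - ?HX) + card (?HX - ?HA) \<le> card ?HA" using le by argo
  moreover have "card ?HA = card (?HA - ?HX) + card (?HA \<inter> ?HX)"
    using fin by (metis add.commute card_Int_Diff)
  moreover have "card ?HX = card (?HX - ?HA) + card (?HA \<inter> ?HX)"
    using fin by (metis add.commute card_Int_Diff inf_commute)
  moreover have "?HA \<inter> ?HX = cut_graph ?HA X" by (auto simp: cut_graph_def)
  ultimately show ?thesis
    using card_cut_graph[OF assms(1,2), of X]
      card_cut_graph[OF fin(1) sym_cut_graph[OF assms(2)], of X] by simp
qed

section \<open>Lower bounds for edge cuts from the minimum degree\<close>

lemma card_edge_cut:
  assumes "finite X" "finite E"
  shows "card (edge_cut E X) = (\<Sum>u\<in>X. card (E `` {u} - X))"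
proof -
  have "edge_cut E X = (SIGMA u:X. E `` {u} - X)" by (auto simp: edge_cut_def)
  moreover have "finite (E `` {u})" for u using assms(2) by (rule finite_Image)
  ultimately show ?thesis using assms(1) by simp
qed

lemma degree_le_outside:
  assumes "finite X" "finite E" "irrefl E" "u \<in> X"
  shows "card (E `` {u}) + 1 \<le> card (E `` {u} - X) + card X"
proof -
  have fin: "finite (E `` {u})" using assms(2) by (rule finite_Image)
  have "E `` {u} \<inter> X \<subseteq> X - {u}" using assms(3) by (auto simp: irrefl_def)
  then have "card (E `` {u} \<inter> X) \<le> card X - 1"
    using card_mono[of "X - {u}"] assms(1,4) by simp
  moreover have "card X > 0" using assms(1,4) card_gt_0_iff by blast
  moreover have "card (E `` {u}) = card (E `` {u} - X) + card (E `` {u} \<inter> X)"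
    using fin by (metis add.commute card_Int_Diff)
  ultimately show ?thesis by linarith
qed

text \<open>A vertex of \<open>X\<close> has at most \<open>card X - 1\<close> neighbours inside
  \<open>X\<close>. Subtraction is truncated, so the bound is trivial once
  \<open>card X > \<delta>\<close>.\<close>

lemma edge_cut_ge:
  assumes "finite X" "finite E" "irrefl E" "\<And>u. u \<in> X \<Longrightarrow> \<delta> \<le> card (E `` {u})"
  shows "card X * (\<delta> + 1 - card X) \<le> card (edge_cut E X)"
proof -
  have "\<delta> + 1 - card X \<le> card (E `` {u} - X)" if "u \<in> X" for u
    using degree_le_outside[OF assms(1-3) that] assms(4)[OF that] by linarith
  then have "(\<Sum>u\<in>X. \<delta> + 1 - card X) \<le> (\<Sum>u\<in>X. card (E `` {u} - X))"
    by (rule sum_mono)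
  then show ?thesis by (simp add: card_edge_cut[OF assms(1,2)])
qed

text \<open>With \<open>card X = c + 1\<close> and \<open>\<delta> = card X + k\<close>, at least
  \<open>(c + 1) * (k + 1) = c * k + \<delta>\<close> edges leave \<open>X\<close>, which is at
  least 3.\<close>

lemma small_edge_cut_imp_large:
  assumes "finite X" "finite E" "irrefl E" "\<And>u. u \<in> X \<Longrightarrow> \<delta> \<le> card (E `` {u})"
    and "3 \<le> \<delta>" "X \<noteq> {}" "card (edge_cut E X) \<le> 2"
  shows "\<delta> + 1 \<le> card X"
proof (rule ccontr)
  assume "\<not> ?thesis"
  then obtain k where k: "\<delta> = card X + k" by (metis Suc_eq_plus1 le_iff_add not_less_eq_eq)
  obtain c where c: "card X = Suc c"
    using assms(1,6) by (metis card_gt_0_iff gr0_implies_Suc)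
  have "Suc c * Suc k \<le> 2" using edge_cut_ge[OF assms(1-4)] assms(7) k c by simp
  moreover have "Suc c * Suc k = c * k + c + k + 1" by simp
  ultimately show False using k c assms(5) by simp
qed

text \<open>If \<open>x\<close> is a further vertex whose neighbours in \<open>L\<close> are \<open>a\<close> and \<open>b\<close>, the conclusion says that
  the cut edges together with \<open>xa\<close> and \<open>xb\<close> form a bipartite 2-edge-connected graph on \<open>L \<union> {x}\<close>.
  The witness is a maximum cut among those keeping \<open>a\<close> and \<open>b\<close> on the same side.\<close>

lemma two_edge_connected_cut:
  assumes "finite L" "E \<subseteq> L \<times> L" "sym E" "irrefl E" and ab: "a \<in> L" "b \<in> L" "a \<noteq> b"
    and deg: "\<And>u. u \<in> L \<Longrightarrow> \<delta> \<le> card (E `` {u}) + (if u \<in> {a, b} then 1 else 0)"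
    and L: "card L + 3 \<le> 2 * \<delta>" and \<delta>: "4 \<le> \<delta>"
  obtains A where "a \<notin> A" "b \<notin> A"
    and "\<And>Y. Y \<subseteq> L \<Longrightarrow> Y \<noteq> {} \<Longrightarrow>
      2 \<le> card (edge_cut (cut_graph E A) Y) + card (Y \<inter> {a, b})"
proof -
  have finE: "finite E" using assms(1,2) by (meson finite_SigmaI finite_subset)
  \<comment> \<open>Complementing a side leaves the cut unchanged, so \<open>a\<close> and
    \<open>b\<close> on a common side may be taken to lie outside \<open>A\<close>.\<close>
  let ?P = "\<lambda>A. a \<notin> A \<and> b \<notin> A"
  have "?P {}" by simp
  moreover have "\<forall>A. ?P A \<longrightarrow> card (cut_graph E A) < Suc (card E)"
    using card_mono[OF finE cut_graph_subset] by (simp add: less_Suc_eq_le)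
  ultimately have "\<exists>A. ?P A \<and> (\<forall>A'. ?P A' \<longrightarrow> card (cut_graph E A') \<le> card (cut_graph E A))"
    by (rule ex_has_greatest_nat)
  then obtain A where A: "a \<notin> A" "b \<notin> A"
    and max: "\<And>A'. a \<notin> A' \<Longrightarrow> b \<notin> A' \<Longrightarrow> card (cut_graph E A') \<le> card (cut_graph E A)"
    by metis
  define H where "H = cut_graph E A"
  have HE: "H \<subseteq> E" and symH: "sym H"
    unfolding H_def using cut_graph_subset sym_cut_graph[OF assms(3)] by auto
  have irreflH: "(z, z) \<notin> H" for z using HE assms(4) by (auto simp: irrefl_def)
  have finH: "finite H" using HE finE by (rule finite_subset)
  have flip: "card (edge_cut E X) \<le> 2 * card (edge_cut H X)" if "a \<notin> X" "b \<notin> X" for X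
    unfolding H_def by (rule edge_cut_le_twice_if_flip_le[OF finE assms(3) max]) (use that A in auto)
  \<comment> \<open>If both \<open>a\<close> and \<open>b\<close> lie in \<open>X\<close>, switch
    \<open>- X\<close> instead, which has the same edges on its boundary.\<close>
  have flip': "card (edge_cut E X) \<le> 2 * card (edge_cut H X)" if "(a \<in> X) = (b \<in> X)" for X
    using flip[of X] flip[of "- X"] that
      card_edge_cut_Compl[OF assms(3), of X] card_edge_cut_Compl[OF symH, of X] by auto
  \<comment> \<open>A single vertex has at least \<open>\<delta> - 1\<close> neighbours in
    \<open>L\<close>; in a larger \<open>Y\<close> at least two vertices have two neighbours outside
    \<open>Y\<close> each.\<close>
  have three: "3 \<le> card (edge_cut E Y)" if Y: "Y \<subseteq> L" "Y \<noteq> {}" "card Y + 2 \<le> \<delta>" for Y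
  proof -
    have finY: "finite Y" using Y(1) assms(1) by (rule finite_subset)
    have bound: "\<delta> \<le> card (E `` {u} - Y) + card Y" if "u \<in> Y" for u
      using degree_le_outside[OF finY finE assms(4) that] deg[of u] that Y(1)
      by (auto split: if_splits)
    show ?thesis
    proof (cases "card Y = 1")
      case True
      then obtain u where "Y = {u}" by (rule card_1_singletonE)
      then show ?thesis using bound[of u] \<delta> card_edge_cut[OF finY finE] by simp
    next
      case False
      moreover have "card Y \<noteq> 0" using finY Y(2) by simp
      ultimately have "2 * 2 \<le> card Y * 2" by linarith
      also have "\<dots> = (\<Sum>u\<in>Y. 2)" by simp
      also have "\<dots> \<le> (\<Sum>u\<in>Y. card (E `` {u} - Y))"
        using bound Y(3) by (intro sum_mono) fastforce
      finally show ?thesis by (simp add: card_edge_cut[OF finY finE])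
    qed
  qed
  have separated: "edge_cut H S \<noteq> {}"
    if pq: "{p, q} = {a, b}" "p \<in> S" "q \<notin> S" and S: "S \<subseteq> L" "card S + 2 \<le> \<delta>" for p q S
  proof
    assume no: "edge_cut H S = {}"
    have finS: "finite S" using S(1) assms(1) by (rule finite_subset)
    have pqA: "p \<notin> A" "q \<notin> A" and pqL: "p \<in> L" "q \<in> L" and "p \<noteq> q"
      and degp: "\<delta> \<le> card (E `` {p}) + 1"
      using pq A ab deg[of p] by (auto simp: doubleton_eq_iff)
    \<comment> \<open>All cut edges leaving \<open>?X\<close> end in \<open>p\<close>, at most one
      per vertex, while at least \<open>4 * card ?X\<close> edges of \<open>E\<close> leave it.
      Since half of these are cut, \<open>?X\<close> is empty and \<open>p\<close> is isolated in
      \<open>H\<close>.\<close>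
    let ?X = "S - {p}"
    have cX: "card S = Suc (card ?X)" using finS pq(2) by (metis card_Suc_Diff1)
    have "edge_cut H ?X \<subseteq> ?X \<times> {p}" using no by (auto simp: edge_cut_def)
    then have "card (edge_cut H ?X) \<le> card ?X"
      using card_mono[of "?X \<times> {p}"] finS by (simp add: card_cartesian_product)
    moreover have "card (edge_cut E ?X) \<le> 2 * card (edge_cut H ?X)"
      using pq by (intro flip) (auto simp: doubleton_eq_iff)
    moreover have "card ?X * (\<delta> + 1 - card ?X) \<le> card (edge_cut E ?X)"
    proof (rule edge_cut_ge[OF _ finE assms(4)])
      fix u assume "u \<in> ?X"
      then have "u \<in> L" "u \<notin> {a, b}" using pq S(1) by (auto simp: doubleton_eq_iff)
      then show "\<delta> \<le> card (E `` {u})" using deg[of u] by simp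
    qed (use finS in simp)
    moreover have "card ?X * 4 \<le> card ?X * (\<delta> + 1 - card ?X)"
      using S(2) cX by (intro mult_le_mono2) simp
    ultimately have "card ?X = 0" by linarith
    then have "?X = {}" using finS by (metis card_eq_0_iff finite_Diff)
    then have Sp: "S = {p}" using pq(2) by auto
    \<comment> \<open>Neighbours of the isolated \<open>p\<close> share its side; cut neighbours of
      \<open>q\<close> lie opposite. Switching \<open>?Y\<close> shows
      \<open>card ?N \<le> card ?M\<close>, and disjointness gives
      \<open>card L \<ge> 2 * \<delta> - 2\<close>, too large.\<close>
    let ?Y = "L - {p, q}"
    let ?N = "E `` {p} - {q}" and ?M = "H `` {q}"
    have pno: "(y, p) \<notin> H" "(p, y) \<notin> H" for y
      using no irreflH[of p] symD[OF symH, of y p] by (auto simp: edge_cut_def Sp)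
    have finNM: "finite ?N" "finite ?M" using finE finH by (auto intro: finite_Image)
    have NY: "?N \<subseteq> ?Y" using assms(2,4) by (auto simp: irrefl_def)
    have MY: "?M \<subseteq> ?Y" using assms(2) HE irreflH pno by auto
    have "?N \<inter> A = {}" using pno(2) pqA by (auto simp: H_def cut_graph_def)
    moreover have "?M \<subseteq> A" using pqA by (auto simp: H_def cut_graph_def)
    ultimately have "?N \<inter> ?M = {}" by blast
    then have "card ?N + card ?M \<le> card ?Y"
      using card_mono[of ?Y "?N \<union> ?M"] NY MY assms(1) finNM by (simp add: card_Un_disjoint)
    moreover have "card ?Y + 2 = card L"
    proof -
      have "card L \<ge> card {p, q}" using pqL assms(1) by (intro card_mono) auto
      then show ?thesis using pqL \<open>p \<noteq> q\<close> by (simp add: card_Diff_subset)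
    qed
    moreover have "\<delta> \<le> card ?N + 2"
    proof -
      have "card (E `` {p}) \<le> card ?N + 1"
        using diff_card_le_card_Diff[of "{q}" "E `` {p}"] by simp
      then show ?thesis using degp by simp
    qed
    moreover have "card ?N + card ?M \<le> card (edge_cut E ?Y)"
    proof -
      have "?N \<times> {p} \<union> ?M \<times> {q} \<subseteq> edge_cut E ?Y"
        using NY MY symD[OF assms(3)] symD[OF symH] HE by (auto simp: edge_cut_def)
      then have "card (?N \<times> {p} \<union> ?M \<times> {q}) \<le> card (edge_cut E ?Y)"
        by (rule card_mono[OF finite_edge_cut[OF finE]])
      moreover have "card (?N \<times> {p} \<union> ?M \<times> {q}) = card ?N + card ?M"
        using finNM \<open>p \<noteq> q\<close> by (subst card_Un_disjoint) (auto simp: card_cartesian_product)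
      ultimately show ?thesis by simp
    qed
    moreover have "card (edge_cut H ?Y) \<le> card ?M"
    proof -
      have "edge_cut H ?Y \<subseteq> ?M \<times> {q}"
        using pno symD[OF symH] HE assms(2) by (auto simp: edge_cut_def)
      then show ?thesis using card_mono[of "?M \<times> {q}"] finNM by (simp add: card_cartesian_product)
    qed
    moreover have "card (edge_cut E ?Y) \<le> 2 * card (edge_cut H ?Y)"
      using pq by (intro flip) auto
    ultimately show False using L by linarith
  qed
  have "2 \<le> card (edge_cut H Y) + card (Y \<inter> {a, b})" if Y: "Y \<subseteq> L" "Y \<noteq> {}" for Y
  proof -
    let ?Z = "L - Y"
    have cZ: "card Y + card ?Z = card L"
      using Y(1) assms(1) by (metis card_Diff_subset card_mono finite_subset le_add_diff_inverse)
    have cutZ: "edge_cut E ?Z = (edge_cut E Y)\<inverse>" "edge_cut H ?Z = (edge_cut H Y)\<inverse>"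
      using edge_cut_Diff[of _ L Y] assms(2) HE edge_cut_Compl[OF assms(3)] edge_cut_Compl[OF symH]
      by auto
    \<comment> \<open>Since \<open>card Y + card ?Z \<le> 2 * \<delta> - 3\<close>, one of the two
      has at most \<open>\<delta> - 2\<close> vertices, and both have the same boundary. Three edges
      of \<open>E\<close> leave at least two in \<open>H\<close>; in the separated case one cut edge
      and one of \<open>a\<close>, \<open>b\<close> suffice.\<close>
    consider (full) "Y = L" | (same) "Y \<noteq> L" "(a \<in> Y) = (b \<in> Y)"
      | (sep) p q where "{p, q} = {a, b}" "p \<in> Y" "q \<notin> Y" by (metis insert_commute)
    then show ?thesis
    proof cases
      case full
      then have "Y \<inter> {a, b} = {a, b}" using ab by auto
      then show ?thesis using ab(3) by simp
    next
      case same
      have "?Z \<noteq> {}" using same(1) Y(1) by auto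
      then have "3 \<le> card (edge_cut E Y)"
        using three[of Y] three[of ?Z] Y cZ L cutZ(1) by (cases "card Y + 2 \<le> \<delta>") auto
      then show ?thesis using flip'[OF same(2)] by simp
    next
      case sep
      have "q \<in> ?Z" "p \<notin> ?Z" "{q, p} = {a, b}" using sep ab by (auto simp: doubleton_eq_iff)
      then have "edge_cut H Y \<noteq> {}"
        using separated[OF sep Y(1)] separated[of q p ?Z] cZ L cutZ(2)
        by (cases "card Y + 2 \<le> \<delta>") auto
      then have "card (edge_cut H Y) \<noteq> 0" using finite_edge_cut[OF finH] by simp
      moreover have "card (Y \<inter> {a, b}) \<noteq> 0" using sep by auto
      ultimately show ?thesis by linarith
    qed
  qed
  then show ?thesis using that A by (simp add: H_def)
qed

section \<open>A bipartite spanning subgraph without three disjoint thin sets\<close>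

lemma bipartite_subgraph_without_three_thin:
  assumes "finite V" "E \<subseteq> V \<times> V" "sym E" "irrefl E"
    and conn: "\<And>X. X \<subseteq> V \<Longrightarrow> X \<noteq> {} \<Longrightarrow> X \<noteq> V \<Longrightarrow> edge_cut E X \<noteq> {}"
    and deg: "\<And>u. u \<in> V \<Longrightarrow> \<delta> \<le> card (E `` {u})"
    and V: "card V \<le> 4 * \<delta>" and \<delta>: "3 \<le> \<delta>"
  obtains H A where "H \<subseteq> cut_graph E A" "sym H"
    and "\<And>X. X \<subseteq> V \<Longrightarrow> X \<noteq> {} \<Longrightarrow> X \<noteq> V \<Longrightarrow> edge_cut H X \<noteq> {}"
    and "\<And>X Y Z. thin H X \<Longrightarrow> thin H Y \<Longrightarrow> thin H Z \<Longrightarrow> X \<union> Y \<union> Z \<subseteq> V \<Longrightarrow>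
      X \<inter> Y = {} \<Longrightarrow> X \<inter> Z = {} \<Longrightarrow> Y \<inter> Z = {} \<Longrightarrow> False"
proof -
  note result = that
  have finE: "finite E" using assms(1,2) by (meson finite_SigmaI finite_subset)
  have "\<forall>A. True \<longrightarrow> card (cut_graph E A) < Suc (card E)"
    using card_mono[OF finE cut_graph_subset] by (simp add: less_Suc_eq_le)
  then have "\<exists>A. True \<and> (\<forall>A'. True \<longrightarrow> card (cut_graph E A') \<le> card (cut_graph E A))"
    by (rule ex_has_greatest_nat[rotated]) simp
  then obtain A where max: "\<And>A'. card (cut_graph E A') \<le> card (cut_graph E A)" by blast
  define H where "H = cut_graph E A"
  have HE: "H \<subseteq> E" and symH: "sym H"
    unfolding H_def using cut_graph_subset sym_cut_graph[OF assms(3)] by auto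
  have HV: "H \<subseteq> V \<times> V" using HE assms(2) by blast
  have finH: "finite H" using HE finE by (rule finite_subset)
  have half: "card (edge_cut E X) \<le> 2 * card (edge_cut H X)" for X
    unfolding H_def by (rule edge_cut_le_twice_if_flip_le[OF finE assms(3) max])
  have connH: "edge_cut H X \<noteq> {}" if "X \<subseteq> V" "X \<noteq> {}" "X \<noteq> V" for X
    using half[of X] conn[OF that] finite_edge_cut[OF finE, of X] by auto
  have thin_cut: "card (edge_cut E X) \<le> 2" if "thin H X" for X
    using half[of X] that by (simp add: thin_def)
  have thin_large: "\<delta> + 1 \<le> card X" if "thin H X" "X \<subseteq> V" for X
  proof (rule small_edge_cut_imp_large[OF _ finE assms(4) _ \<delta> _ thin_cut[OF that(1)]])
    show "finite X" using that(2) assms(1) by (rule finite_subset)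
    show "X \<noteq> {}" using that(1) by (simp add: thin_def)
  qed (use that(2) deg in blast)
  have thin_single: "edge_cut H X = {e}" if "thin H X" "e \<in> edge_cut H X" for X e
  proof -
    have "\<forall>e'\<in>edge_cut H X. e' = e"
      using that finite_edge_cut[OF finH, of X] by (simp add: thin_def card_le_Suc0_iff_eq)
    then show ?thesis using that(2) by blast
  qed
  \<comment> \<open>The only edge leaving \<open>X\<close> is then also the only edge leaving
    \<open>Y\<close>, so no edge leaves the union and connectivity applies.\<close>
  have joined: "X \<union> Y = V" if XY: "thin H X" "thin H Y" "X \<subseteq> V" "Y \<subseteq> V" "X \<inter> Y = {}"
    and pq: "(p, q) \<in> edge_cut H X" "q \<in> Y" for X Y p q
  proof (rule ccontr)
    assume "X \<union> Y \<noteq> V"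
    moreover have "X \<noteq> {}" using XY(1) by (simp add: thin_def)
    ultimately have "edge_cut H (X \<union> Y) \<noteq> {}" using XY by (intro connH) auto
    then obtain s t where st: "(s, t) \<in> H" "s \<in> X \<union> Y" "t \<notin> X \<union> Y" by (auto simp: edge_cut_def)
    have "(q, p) \<in> edge_cut H Y" using pq XY(5) symD[OF symH] by (auto simp: edge_cut_def)
    then have "edge_cut H Y = {(q, p)}" "edge_cut H X = {(p, q)}"
      using XY pq by (auto dest!: thin_single)
    moreover have "(s, t) \<in> edge_cut H X \<or> (s, t) \<in> edge_cut H Y"
      using st by (auto simp: edge_cut_def)
    moreover have "p \<in> X" using pq by (simp add: edge_cut_def)
    ultimately show False using st(3) pq(2) by auto
  qed
  have card3: "card (X \<union> Y \<union> Z) = card X + card Y + card Z"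
    if "X \<union> Y \<union> Z \<subseteq> V" "X \<inter> Y = {}" "X \<inter> Z = {}" "Y \<inter> Z = {}" for X Y Z
  proof -
    have "finite X" "finite Y" "finite Z" using that(1) assms(1) by (auto intro: finite_subset)
    then show ?thesis using that by (subst card_Un_disjoint, auto)+
  qed
  have three: "\<exists>x. V - (X \<union> Y \<union> Z) = {x} \<and> 4 \<le> \<delta>"
    if thin: "thin H X" "thin H Y" "thin H Z" and sub: "X \<union> Y \<union> Z \<subseteq> V"
      and disj: "X \<inter> Y = {}" "X \<inter> Z = {}" "Y \<inter> Z = {}" for X Y Z
  proof -
    define M where "M = V - (X \<union> Y \<union> Z)"
    have finM: "finite M" using assms(1) by (simp add: M_def)
    have "card M + card (X \<union> Y \<union> Z) = card V"
      unfolding M_def using sub assms(1)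
      by (metis add.commute card_Diff_subset card_mono finite_subset le_add_diff_inverse)
    \<comment> \<open>Three sets of at least \<open>\<delta> + 1\<close> vertices each are taken out
      of at most \<open>4 * \<delta>\<close>.\<close>
    then have cM: "card M + 3 \<le> \<delta>"
      using card3[OF sub disj] V thin[THEN thin_large] sub by auto
    \<comment> \<open>If the three sets covered \<open>V\<close>, an edge leaving \<open>X\<close>
      would end in another of them, and \<open>joined\<close> would leave no room for the
      third.\<close>
    have "M \<noteq> {}"
    proof
      assume "M = {}"
      then have Veq: "V = X \<union> Y \<union> Z" using sub by (auto simp: M_def)
      have ne: "X \<noteq> {}" "Y \<noteq> {}" "Z \<noteq> {}" using thin by (auto simp: thin_def)
      then have "X \<noteq> V" using disj sub by auto
      then obtain p q where pq: "(p, q) \<in> edge_cut H X"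
        using connH[of X] ne sub by auto
      then have "q \<in> Y \<or> q \<in> Z" using HV Veq by (auto simp: edge_cut_def)
      then have "X \<union> Y = V \<or> X \<union> Z = V"
        using joined[OF thin(1,2) _ _ disj(1) pq] joined[OF thin(1,3) _ _ disj(2) pq] sub by auto
      then show False using ne disj sub by blast
    qed
    \<comment> \<open>Every edge leaving \<open>M\<close> enters one of the three sets, each of
      which has at most two such edges. With the degree bound this yields
      \<open>4 * card M \<le> 6\<close>.\<close>
    have "edge_cut E M \<subseteq> (edge_cut E X \<union> edge_cut E Y \<union> edge_cut E Z)\<inverse>"
      using symD[OF assms(3)] assms(2) by (auto simp: edge_cut_def M_def)
    then have "card (edge_cut E M) \<le> card ((edge_cut E X \<union> edge_cut E Y \<union> edge_cut E Z)\<inverse>)"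
      by (rule card_mono[rotated]) (simp add: finite_edge_cut finE)
    also have "\<dots> \<le> card (edge_cut E X) + card (edge_cut E Y) + card (edge_cut E Z)"
      by (simp add: order_trans[OF card_Un_le] card_Un_le)
    also have "\<dots> \<le> 6" using thin[THEN thin_cut] by linarith
    finally have "card (edge_cut E M) \<le> 6" .
    moreover have "card M * (\<delta> + 1 - card M) \<le> card (edge_cut E M)"
      by (rule edge_cut_ge[OF finM finE assms(4)]) (auto simp: M_def deg)
    moreover have "card M * 4 \<le> card M * (\<delta> + 1 - card M)"
      using cM by (intro mult_le_mono2) simp
    moreover have "card M \<noteq> 0" using finM \<open>M \<noteq> {}\<close> by simp
    ultimately have M1: "card M = 1" by linarith
    then obtain x where "M = {x}" by (rule card_1_singletonE)
    then show ?thesis using M1 cM by (auto simp: M_def)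
  qed
  show ?thesis
  proof (cases "\<exists>X Y Z. thin H X \<and> thin H Y \<and> thin H Z \<and> X \<union> Y \<union> Z \<subseteq> V \<and>
      X \<inter> Y = {} \<and> X \<inter> Z = {} \<and> Y \<inter> Z = {}")
    case False
    then show ?thesis using that[of H A] connH symH unfolding H_def by blast
  next
    case True
    have special: thesis
      if thin: "thin H L" "thin H L1" "thin H L2" and sub: "L \<union> L1 \<union> L2 \<subseteq> V"
        and disj: "L \<inter> L1 = {}" "L \<inter> L2 = {}" "L1 \<inter> L2 = {}"
        and x: "V - (L \<union> L1 \<union> L2) = {x}" and two: "2 \<le> card (E `` {x} \<inter> L)"
      for L L1 L2 x
    proof -
      have \<delta>4: "4 \<le> \<delta>" using three[OF thin sub disj] by blast
      have xV: "x \<in> V" "x \<notin> L" "x \<notin> L1" "x \<notin> L2" using x by auto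
      have Veq: "V = insert x (L \<union> L1 \<union> L2)" using x sub by auto
      have finL: "finite L" using sub assms(1) by (auto intro: finite_subset)
      obtain a b where ab: "a \<noteq> b" "a \<in> L" "b \<in> L" "(x, a) \<in> E" "(x, b) \<in> E"
      proof -
        obtain T where "T \<subseteq> E `` {x} \<inter> L" "card T = 2"
          using obtain_subset_with_card_n[OF two] by metis
        then show ?thesis using that by (auto simp: card_2_iff)
      qed
      have abE: "(a, x) \<in> E" "(b, x) \<in> E" using ab symD[OF assms(3)] by auto
      have cutL: "edge_cut E L = {(a, x), (b, x)}"
      proof (rule card_seteq[symmetric, OF finite_edge_cut[OF finE]])
        show "{(a, x), (b, x)} \<subseteq> edge_cut E L" using ab abE xV by (auto simp: edge_cut_def)
        show "card (edge_cut E L) \<le> card {(a, x), (b, x)}" using thin_cut[OF thin(1)] ab by simp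
      qed
      have exitL: "v = x \<and> u \<in> {a, b}" if "(u, v) \<in> E" "u \<in> L" "v \<notin> L" for u v
      proof -
        have "(u, v) \<in> edge_cut E L" using that by (simp add: edge_cut_def)
        then show ?thesis unfolding cutL by blast
      qed
      let ?EL = "E \<inter> L \<times> L"
      have "card V = card L + card L1 + card L2 + 1"
        using card3[OF sub disj] xV sub assms(1) finite_subset[OF sub] by (subst Veq) simp
      \<comment> \<open>The other two sets and \<open>x\<close> use at least
        \<open>2 * \<delta> + 3\<close> of the at most \<open>4 * \<delta>\<close> vertices.\<close>
      then have cL: "card L + 3 \<le> 2 * \<delta>" using V thin[THEN thin_large] sub by auto
      obtain B where B: "a \<notin> B" "b \<notin> B"
        and HL: "\<And>Y. Y \<subseteq> L \<Longrightarrow> Y \<noteq> {} \<Longrightarrow>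
          2 \<le> card (edge_cut (cut_graph ?EL B) Y) + card (Y \<inter> {a, b})"
      proof (rule two_edge_connected_cut[of L ?EL a b \<delta>])
        show "sym ?EL" using assms(3) by (auto simp: sym_def)
        show "irrefl ?EL" using assms(4) by (auto simp: irrefl_def)
        fix u assume u: "u \<in> L"
        have fin: "finite (?EL `` {u})" using finE by (intro finite_Image) simp
        \<comment> \<open>Only \<open>ax\<close> and \<open>bx\<close> leave \<open>L\<close>, so
          restricting to \<open>L\<close> costs one neighbour at \<open>a\<close> and
          \<open>b\<close> and none elsewhere.\<close>
        show "\<delta> \<le> card (?EL `` {u}) + (if u \<in> {a, b} then 1 else 0)"
        proof (cases "u \<in> {a, b}")
          case True
          have "E `` {u} \<subseteq> insert x (?EL `` {u})" using exitL u by blast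
          then have "card (E `` {u}) \<le> card (insert x (?EL `` {u}))"
            using fin by (intro card_mono) auto
          also have "\<dots> \<le> card (?EL `` {u}) + 1" using fin by (simp add: card_insert_if)
          finally show ?thesis using True deg[of u] u sub by auto
        next
          case False
          have "E `` {u} \<subseteq> ?EL `` {u}" using exitL u False by blast
          then have "card (E `` {u}) \<le> card (?EL `` {u})" using fin by (intro card_mono) auto
          then show ?thesis using False deg[of u] u sub by auto
        qed
      qed (use finL ab cL \<delta>4 in auto)
      define HL where "HL = cut_graph ?EL B"
      define H' where "H' = H \<inter> (- L) \<times> (- L) \<union> HL \<union> {(a, x), (b, x), (x, a), (x, b)}"
      \<comment> \<open>Off \<open>L\<close> the sides are swapped if necessary so that
        \<open>x\<close> lies in \<open>A'\<close>. As \<open>a\<close> and \<open>b\<close> are not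
        in \<open>B\<close>, both \<open>xa\<close> and \<open>xb\<close> become cut edges.\<close>
      define A' where "A' = ((if x \<in> A then A else - A) - L) \<union> (B \<inter> L)"
      have H'E: "H' \<subseteq> cut_graph E A'"
        using ab abE xV B by (auto simp: H'_def A'_def H_def HL_def cut_graph_def)
      have HL_L: "HL \<subseteq> L \<times> L" by (auto simp: HL_def cut_graph_def)
      have symH': "sym H'"
        using symH sym_cut_graph[of ?EL B] assms(3) by (auto simp: H'_def HL_def sym_def)
      have finH': "finite H'" using H'E cut_graph_subset finE by (metis finite_subset)
      define Z where "Z = insert x L"
      \<comment> \<open>The summand \<open>card (?Y \<inter> {a, b})\<close> counts the edges from
        \<open>?Y\<close> to \<open>x\<close>. Sets containing \<open>x\<close> follow by
        complementation, so no thin set splits \<open>Z\<close>.\<close>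
      have two0: "2 \<le> card (edge_cut H' X)" if "X \<inter> Z \<noteq> {}" "x \<notin> X" for X
      proof -
        let ?Y = "X \<inter> L"
        have "?Y \<noteq> {}" using that by (auto simp: Z_def)
        then have "2 \<le> card (edge_cut HL ?Y) + card (?Y \<inter> {a, b})"
          using HL[of ?Y] by (simp add: HL_def)
        also have "\<dots> = card (edge_cut HL ?Y \<union> (?Y \<inter> {a, b}) \<times> {x})"
        proof (subst card_Un_disjoint)
          show "finite (edge_cut HL ?Y)"
            using finH' by (intro finite_edge_cut) (auto simp: H'_def)
          show "edge_cut HL ?Y \<inter> (?Y \<inter> {a, b}) \<times> {x} = {}"
            using HL_L xV by (auto simp: edge_cut_def)
        qed (auto simp: card_cartesian_product)
        also have "\<dots> \<le> card (edge_cut H' X)"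
          using HL_L that(2) by (intro card_mono finite_edge_cut[OF finH']) (auto simp: edge_cut_def H'_def)
        finally show ?thesis .
      qed
      have two: "2 \<le> card (edge_cut H' X)" if "X \<inter> Z \<noteq> {}" "\<not> Z \<subseteq> X" for X
      proof (cases "x \<in> X")
        case True
        then have "2 \<le> card (edge_cut H' (- X))" using that by (intro two0) (auto simp: Z_def)
        then show ?thesis by (simp add: card_edge_cut_Compl[OF symH'])
      qed (use that two0 in blast)
      \<comment> \<open>The edge leaving \<open>P\<close> cannot end in \<open>L\<close> or
        \<open>Q\<close>, since by \<open>joined\<close> the two sets would exhaust \<open>V\<close>
        without \<open>x\<close>.\<close>
      have attach: "\<exists>p\<in>P. edge_cut H P = {(p, x)}"
        if P: "thin H P" "P \<subseteq> V" and Q: "thin H Q" "Q \<subseteq> V"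
          and LPQ: "L \<inter> P = {}" "P \<inter> Q = {}" "V = insert x (L \<union> P \<union> Q)"
          "x \<notin> P" "x \<notin> Q" for P Q
      proof -
        have "P \<noteq> {}" "P \<noteq> V" using P LPQ xV by (auto simp: thin_def)
        then obtain p q where pq: "(p, q) \<in> edge_cut H P" using connH[OF P(2)] by auto
        then have "p \<in> P" "q \<in> V" "q \<notin> P" using HV by (auto simp: edge_cut_def)
        moreover have "q \<notin> L"
          using joined[OF P(1) thin(1) P(2) _ _ pq] LPQ sub xV by auto
        moreover have "q \<notin> Q"
          using joined[OF P(1) Q(1) P(2) Q(2) LPQ(2) pq] LPQ xV by auto
        ultimately have "q = x" using LPQ(3) by auto
        then show ?thesis using thin_single[OF P(1) pq] \<open>p \<in> P\<close> by auto
      qed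
      obtain p1 where p1: "p1 \<in> L1" "edge_cut H L1 = {(p1, x)}"
        using attach[OF thin(2) _ thin(3)] sub disj Veq xV by auto
      obtain p2 where p2: "p2 \<in> L2" "edge_cut H L2 = {(p2, x)}"
        using attach[OF thin(3) _ thin(2)] sub disj Veq xV by auto
      \<comment> \<open>\<open>L1\<close> and \<open>L2\<close> are attached to \<open>x\<close>
        only, so no edge of \<open>H\<close> joins them to \<open>L\<close>, where the cut was
        changed.\<close>
      have outside: "edge_cut H' X = edge_cut H X" if "X \<subseteq> V" "X \<inter> Z = {}" for X
      proof -
        have X12: "X \<subseteq> L1 \<union> L2" "x \<notin> X" using that Veq by (auto simp: Z_def)
        have "v \<notin> L" if "(u, v) \<in> H" "u \<in> X" for u v
        proof
          assume "v \<in> L"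
          then have "(u, v) \<in> edge_cut H L1 \<or> (u, v) \<in> edge_cut H L2"
            using that X12 disj by (auto simp: edge_cut_def)
          then show False using p1 p2 xV \<open>v \<in> L\<close> by auto
        qed
        moreover have "u \<notin> L" if "u \<in> X" for u using that X12 disj by auto
        ultimately show ?thesis
          using X12 ab HL_L by (auto simp: edge_cut_def H'_def)
      qed
      have connH': "edge_cut H' X \<noteq> {}" if X: "X \<subseteq> V" "X \<noteq> {}" "X \<noteq> V" for X
      proof
        assume no: "edge_cut H' X = {}"
        then have "X \<inter> Z = {} \<or> Z \<subseteq> X" using two[of X] by auto
        then show False
        proof
          assume "X \<inter> Z = {}"
          then show False using outside[OF X(1)] connH[OF X] no by simp
        next
          assume "Z \<subseteq> X"
          then have "edge_cut H (V - X) = edge_cut H' (V - X)" by (intro outside[symmetric]) auto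
          also have "\<dots> = edge_cut H' (- X)"
            using H'E cut_graph_subset[of E A'] assms(2) by (intro edge_cut_Diff) blast
          also have "\<dots> = {}" by (simp add: edge_cut_Compl[OF symH'] no)
          finally show False using connH[of "V - X"] X by auto
        qed
      qed
      have thinZ: "X \<inter> Z = {} \<or> Z \<subseteq> X" if "thin H' X" for X
        using two[of X] that by (auto simp: thin_def)
      \<comment> \<open>\<open>X\<close>, \<open>Y\<close> and \<open>L\<close> are disjoint and
        thin in the old cut, so by \<open>three\<close> only \<open>x\<close> lies outside them.
        Hence the third set is \<open>Z\<close>, but the edges from \<open>x\<close> to
        \<open>L1\<close> and to \<open>L2\<close> both leave \<open>Z\<close>.\<close>
      have avoid2: False
        if thin': "thin H' X" "thin H' Y" "thin H' W" and sub': "X \<union> Y \<union> W \<subseteq> V"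
          and disj': "X \<inter> Y = {}" "X \<inter> W = {}" "Y \<inter> W = {}"
          and avoid: "X \<inter> Z = {}" "Y \<inter> Z = {}" for X Y W
      proof -
        have "thin H X" "thin H Y"
          using thin' outside[of X] outside[of Y] avoid sub' by (auto simp: thin_def)
        moreover have "X \<inter> L = {}" "Y \<inter> L = {}" using avoid by (auto simp: Z_def)
        moreover have "X \<union> Y \<union> L \<subseteq> V" using sub sub' by blast
        ultimately obtain x' where "V - (X \<union> Y \<union> L) = {x'}"
          using three[of X Y L] thin(1) disj'(1) by metis
        moreover have "x \<in> V - (X \<union> Y \<union> L)" using xV avoid by (auto simp: Z_def)
        ultimately have "W \<subseteq> Z" using sub' disj' by (auto simp: Z_def)
        moreover have "W \<noteq> {}" using thin'(3) by (simp add: thin_def)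
        ultimately have "W = Z" using thinZ[OF thin'(3)] by auto
        have "(p1, x) \<in> H" "(p2, x) \<in> H" using p1 p2 by (auto simp: edge_cut_def)
        then have "(x, p1) \<in> H" "(x, p2) \<in> H" using symD[OF symH] by auto
        then have "{(x, p1), (x, p2)} \<subseteq> edge_cut H' Z"
          using p1 p2 disj xV by (auto simp: edge_cut_def H'_def Z_def)
        then have "card {(x, p1), (x, p2)} \<le> card (edge_cut H' Z)"
          by (rule card_mono[OF finite_edge_cut[OF finH']])
        moreover have "p1 \<noteq> p2" using p1 p2 disj by auto
        ultimately show False using thin'(3) \<open>W = Z\<close> by (simp add: thin_def)
      qed
      show thesis
      proof (rule result[OF H'E symH' connH'])
        fix X Y W
        assume h: "thin H' X" "thin H' Y" "thin H' W" "X \<union> Y \<union> W \<subseteq> V"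
          "X \<inter> Y = {}" "X \<inter> W = {}" "Y \<inter> W = {}"
        have "Z \<noteq> {}" by (simp add: Z_def)
        \<comment> \<open>At most one of three disjoint sets contains \<open>Z\<close>; the other
          two avoid it.\<close>
        then have "X \<inter> Z = {} \<and> Y \<inter> Z = {} \<or> X \<inter> Z = {} \<and> W \<inter> Z = {} \<or> Y \<inter> Z = {} \<and> W \<inter> Z = {}"
          using h(5-7) thinZ[OF h(1)] thinZ[OF h(2)] thinZ[OF h(3)] by blast
        moreover have "X \<union> W \<union> Y \<subseteq> V" "Y \<union> W \<union> X \<subseteq> V" "Y \<inter> X = {}" "W \<inter> X = {}" "W \<inter> Y = {}"
          using h(4-7) by auto
        ultimately show False
          using h avoid2[of X Y W] avoid2[of X W Y] avoid2[of Y W X] by metis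
      qed
    qed
    from True obtain X Y Z where
      XYZ: "thin H X" "thin H Y" "thin H Z" "X \<union> Y \<union> Z \<subseteq> V" "X \<inter> Y = {}" "X \<inter> Z = {}" "Y \<inter> Z = {}"
      by blast
    then obtain x where x: "V - (X \<union> Y \<union> Z) = {x}" "4 \<le> \<delta>" using three by blast
    then have xV: "x \<in> V" by blast
    let ?N = "\<lambda>S. E `` {x} \<inter> S"
    have finN: "finite (E `` {x})" using finE by (rule finite_Image)
    \<comment> \<open>Pigeonhole: \<open>x\<close> has at least four neighbours, all in the three
      sets, so one set contains two and takes the role of \<open>L\<close>.\<close>
    have "E `` {x} \<subseteq> ?N X \<union> ?N Y \<union> ?N Z"
      using x(1) assms(2,4) by (auto simp: irrefl_def)
    then have "card (E `` {x}) \<le> card (?N X \<union> ?N Y \<union> ?N Z)"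
      using finN by (intro card_mono) auto
    also have "\<dots> \<le> card (?N X) + card (?N Y) + card (?N Z)"
      by (meson card_Un_le add_le_mono1 order_trans)
    finally have "2 \<le> card (?N X) \<or> 2 \<le> card (?N Y) \<or> 2 \<le> card (?N Z)"
      using deg[OF xV] x(2) by linarith
    moreover have "Y \<union> X \<union> Z = X \<union> Y \<union> Z" "Z \<union> X \<union> Y = X \<union> Y \<union> Z"
      "Y \<inter> X = {}" "Z \<inter> X = {}" "Z \<inter> Y = {}" using XYZ(5-7) by auto
    ultimately show thesis
      using special[of X Y Z x] special[of Y X Z x] special[of Z X Y x] XYZ x(1) by metis
  qed
qed

section \<open>Alternating colorings\<close>

text \<open>Walks grow at the front; when the new vertex already occurs, the path restarts at that
  occurrence, which cuts out the cycle.\<close>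

lemma rtrancl_imp_distinct_vwalk:
  assumes "(u, v) \<in> R\<^sup>*"
  obtains p where "p \<noteq> []" "hd p = u" "last p = v" "distinct p" "set (vwalk_arcs p) \<subseteq> R"
proof -
  have "\<exists>p. p \<noteq> [] \<and> hd p = u \<and> last p = v \<and> distinct p \<and> set (vwalk_arcs p) \<subseteq> R"
    using assms
  proof (induction rule: converse_rtrancl_induct)
    case base
    show ?case by (intro exI[of _ "[v]"]) simp
  next
    case (step s t)
    then obtain p where p: "p \<noteq> []" "hd p = t" "last p = v" "distinct p" "set (vwalk_arcs p) \<subseteq> R"
      by blast
    show ?case
    proof (cases "s \<in> set p")
      case True
      then obtain ys zs where p_eq: "p = ys @ s # zs" by (meson split_list)
      have "set (vwalk_arcs (s # zs)) \<subseteq> R"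
        using p(5) set_vwalk_arcs_append2[of "s # zs" ys] unfolding p_eq by blast
      then show ?thesis using p by (intro exI[of _ "s # zs"]) (simp add: p_eq)
    next
      case False
      then show ?thesis using p step.hyps(1) by (intro exI[of _ "s # p"]) simp
    qed
  qed
  then show ?thesis using that by blast
qed

lemma vwalk_arcs_nth: "Suc i < length p \<Longrightarrow> (p ! i, p ! Suc i) \<in> set (vwalk_arcs p)"
proof (induction p arbitrary: i rule: vwalk_arcs.induct)
  case (3 x y xs)
  then show ?case by (cases i) auto
qed auto

lemma proper_path_if_alternating:
  assumes "wf_digraph G" "R \<subseteq> arcs_ends G" "(u, v) \<in> R\<^sup>*" "u \<in> verts G"
    and alt: "\<And>p q s. (p, q) \<in> R \<Longrightarrow> (q, s) \<in> R \<Longrightarrow> c {p, q} \<noteq> c {q, s}"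
  shows "\<exists>p. proper_path G c p \<and> hd p = u \<and> last p = v"
proof -
  interpret wf_digraph G by fact
  obtain p where p: "p \<noteq> []" "hd p = u" "last p = v" "distinct p" "set (vwalk_arcs p) \<subseteq> R"
    using rtrancl_imp_distinct_vwalk[OF assms(3)] by blast
  have "p ! i \<in> verts G" if "i < length p" for i
  proof (cases i)
    case 0
    then show ?thesis using p(1,2) assms(4) by (simp add: hd_conv_nth)
  next
    case (Suc j)
    then have "(p ! j, p ! i) \<in> arcs_ends G" using vwalk_arcs_nth[of j p] that p(5) assms(2) by auto
    then show ?thesis by (rule adj_in_verts(2))
  qed
  then have "set p \<subseteq> verts G" by (auto simp: in_set_conv_nth)
  then have "vpath p G" using p assms(2) by (intro vpathI vwalkI) auto
  moreover have "c {p ! i, p ! (i + 1)} \<noteq> c {p ! (i + 1), p ! (i + 2)}" if "i + 2 < length p" for i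
    using alt[of "p ! i" "p ! Suc i" "p ! Suc (Suc i)"] vwalk_arcs_nth[of i p]
      vwalk_arcs_nth[of "Suc i" p] that p(5) by auto
  ultimately show ?thesis using p by (auto simp: proper_path_def)
qed

text \<open>The color records whether the oriented edge starts in \<open>A\<close>, which alternates
  along directed paths. Reversal keeps a path proper, so reachability in one direction
  suffices.\<close>

lemma bipartite_orientation_coloring:
  assumes "wf_digraph G" "symmetric G" "D \<subseteq> cut_graph (arcs_ends G) A" "asym D"
    and uni: "\<And>u v. u \<in> verts G \<Longrightarrow> v \<in> verts G \<Longrightarrow> (u, v) \<in> D\<^sup>* \<or> (v, u) \<in> D\<^sup>*"
  obtains c where "proper_connected G c" "range c \<subseteq> {0, 1}"
proof -
  define c :: "'a set \<Rightarrow> nat"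
    where "c e = (if \<exists>p q. e = {p, q} \<and> (p, q) \<in> D \<and> p \<in> A then 1 else 0)" for e
  \<comment> \<open>Asymmetry ensures that an unordered pair carries only one orientation. Pairs
    without one get the default 0.\<close>
  have c: "c {p, q} = (if p \<in> A then 1 else 0)" if "(p, q) \<in> D" for p q
    using that assms(4) by (auto simp: c_def doubleton_eq_iff dest: asymD)
  have alt: "c {p, q} \<noteq> c {q, s}" if "(p, q) \<in> D" "(q, s) \<in> D" for p q s
  proof -
    have "(p \<in> A) \<noteq> (q \<in> A)" using that(1) assms(3) by (auto simp: cut_graph_def)
    then show ?thesis using c[OF that(1)] c[OF that(2)] by auto
  qed
  have alt': "c {p, q} \<noteq> c {q, s}" if "(p, q) \<in> D\<inverse>" "(q, s) \<in> D\<inverse>" for p q s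
    using alt[of s q p] that by (simp add: insert_commute)
  have DE: "D \<subseteq> arcs_ends G" using assms(3) cut_graph_subset by blast
  then have DE': "D\<inverse> \<subseteq> arcs_ends G" using assms(2) by (auto simp: symmetric_def dest: symD)
  have "\<exists>p. proper_path G c p \<and> hd p = u \<and> last p = v" if "u \<in> verts G" "v \<in> verts G" for u v
  proof -
    have "(u, v) \<in> D\<^sup>* \<or> (u, v) \<in> (D\<inverse>)\<^sup>*" using uni[OF that] by (simp add: rtrancl_converse)
    then show ?thesis
    proof
      assume "(u, v) \<in> D\<^sup>*"
      then show ?thesis by (rule proper_path_if_alternating[OF assms(1) DE]) (fact that(1), rule alt)
    next
      assume "(u, v) \<in> (D\<inverse>)\<^sup>*"
      then show ?thesis by (rule proper_path_if_alternating[OF assms(1) DE']) (fact that(1), rule alt')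
    qed
  qed
  then have "proper_connected G c" by (simp add: proper_connected_def)
  moreover have "range c \<subseteq> {0, 1}" by (auto simp: c_def)
  ultimately show ?thesis by (rule that)
qed

section \<open>Lower bound and conclusion\<close>

text \<open>A proper path between nonadjacent vertices has at least two edges, and its first two
  differ in color.\<close>

lemma two_le_colors_if_noncomplete:
  assumes "graph G" "\<not> complete_digraph (card (verts G)) G" "proper_connected G c"
  shows "2 \<le> card (c ` edges G)"
proof -
  interpret graph G by fact
  have "edges G \<subseteq> (\<lambda>(u, v). {u, v}) ` (arcs_ends G)" by (auto simp: edges_def)
  moreover have "finite (arcs_ends G)" by (simp add: arcs_ends_conv)
  ultimately have fin: "finite (c ` edges G)" by (meson finite_imageI finite_subset)
  have "arcs_ends G \<subseteq> {(u, v). (u, v) \<in> verts G \<times> verts G \<and> u \<noteq> v}"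
    using adj_in_verts adj_not_same by auto
  then obtain u v where uv: "u \<in> verts G" "v \<in> verts G" "u \<noteq> v" "(u, v) \<notin> arcs_ends G"
    using assms(1,2) unfolding complete_digraph_def by auto
  then obtain p where p: "proper_path G c p" "hd p = u" "last p = v"
    using assms(3) unfolding proper_connected_def by blast
  then have w: "p \<noteq> []" "set (vwalk_arcs p) \<subseteq> arcs_ends G"
    by (auto simp: proper_path_def vpath_def vwalk_def)
  have len: "2 < length p"
  proof (rule ccontr)
    assume "\<not> 2 < length p"
    then consider "length p = 1" | "length p = 2" using w(1)
      length_0_conv[of p] by linarith
    then show False
    proof cases
      case 1
      then show False using p uv(3) by (auto simp: length_Suc_conv)
    next
      case 2
      then obtain x y where "p = [x, y]" by (auto simp: length_Suc_conv numeral_2_eq_2)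
      then show False using p w(2) uv(4) by simp
    qed
  qed
  have e: "{p ! i, p ! (i + 1)} \<in> edges G" if "i + 1 < length p" for i
    using vwalk_arcs_nth[of i p] that w(2) by (auto simp: edges_def)
  have "c {p ! 0, p ! (0 + 1)} \<noteq> c {p ! (0 + 1), p ! (0 + 2)}"
    using p(1) len unfolding proper_path_def by (metis add_0)
  moreover have "{p ! 0, p ! (0 + 1)} \<in> edges G" "{p ! (0 + 1), p ! (0 + 2)} \<in> edges G"
    using e[of 0] e[of 1] len by auto
  ultimately have "card {c {p ! 0, p ! (0 + 1)}, c {p ! (0 + 1), p ! (0 + 2)}} = 2"
    "{c {p ! 0, p ! (0 + 1)}, c {p ! (0 + 1), p ! (0 + 2)}} \<subseteq> c ` edges G" by auto
  then show ?thesis using card_mono[OF fin] by metis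
qed

theorem theorem7:
  fixes G :: "('a, 'b) pre_digraph" and n :: nat
  assumes "graph G"
    and "Digraph_Component.connected G"
    and "card (verts G) = n"
    and "\<not> complete_digraph n G"
    and "n \<ge> 9"
    and "real (min_degree G) \<ge> real n / 4"
  shows "proper_connection_number G = 2"
proof -
  interpret graph G by fact
  let ?V = "verts G" and ?E = "arcs_ends G"
  have V_ne: "?V \<noteq> {}" using assms(3,5) by auto
  have symE: "sym ?E" using sym_arcs by (simp add: symmetric_def)
  have irreflE: "irrefl ?E" using adj_not_same by (auto simp: irrefl_def)
  have EV: "?E \<subseteq> ?V \<times> ?V" using adj_in_verts by auto
  have conn: "edge_cut ?E X \<noteq> {}" if X: "X \<subseteq> ?V" "X \<noteq> {}" "X \<noteq> ?V" for X
  proof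
    assume no: "edge_cut ?E X = {}"
    obtain u v where uv: "u \<in> X" "v \<in> ?V" "v \<notin> X" using X by auto
    have "strongly_connected G"
      using symmetric_connected_imp_strongly_connected assms(2) sym_arcs by blast
    then have "u \<rightarrow>\<^sup>*\<^bsub>G\<^esub> v" using uv X(1) by (auto simp: strongly_connected_def)
    then have "(u, v) \<in> ?E\<^sup>*" by (rule reachable_rtranclI)
    then have "v \<in> X" by induction (use uv(1) no in \<open>auto simp: edge_cut_def\<close>)
    then show False using uv(3) by simp
  qed
  have deg: "min_degree G \<le> card (?E `` {u})" if "u \<in> ?V" for u
  proof -
    have "min_degree G \<le> out_degree G u" unfolding min_degree_def using that by (intro Min_le) auto
    \<comment> \<open>Without parallel arcs, counting arcs out of \<open>u\<close> is counting
      neighbours.\<close>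
    also have "out_degree G u = card (head G ` out_arcs G u)"
    proof -
      have "inj_on (head G) (out_arcs G u)"
        by (rule inj_onI) (auto simp: out_arcs_def arc_to_ends_def intro: no_multi_arcs)
      then show ?thesis by (simp add: out_degree_def card_image)
    qed
    also have "head G ` out_arcs G u = ?E `` {u}" by (auto simp: out_arcs_def arcs_ends_conv)
    finally show ?thesis .
  qed
  \<comment> \<open>From \<open>n \<ge> 9\<close> the minimum degree is at least 9/4, hence at least
    3 by integrality.\<close>
  have size: "card ?V \<le> 4 * min_degree G" "3 \<le> min_degree G" using assms(3,5,6) by linarith+
  have "\<exists>c. proper_connected G c \<and> range c \<subseteq> {0, 1}"
  proof (rule bipartite_subgraph_without_three_thin[OF finite_verts EV symE irreflE conn deg size])
    fix H A
    assume H: "H \<subseteq> cut_graph ?E A" "sym H"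
      and H_conn: "\<And>X. X \<subseteq> ?V \<Longrightarrow> X \<noteq> {} \<Longrightarrow> X \<noteq> ?V \<Longrightarrow> edge_cut H X \<noteq> {}"
      and H_thin: "\<And>X Y Z. thin H X \<Longrightarrow> thin H Y \<Longrightarrow> thin H Z \<Longrightarrow> X \<union> Y \<union> Z \<subseteq> ?V \<Longrightarrow>
        X \<inter> Y = {} \<Longrightarrow> X \<inter> Z = {} \<Longrightarrow> Y \<inter> Z = {} \<Longrightarrow> False"
    have HV: "H \<subseteq> ?V \<times> ?V" using H(1) cut_graph_subset EV by blast
    show ?thesis
    proof (rule unilateral_orientation[OF finite_verts V_ne HV H(2) H_conn H_thin])
      fix D
      assume D: "D \<subseteq> H" "asym D" "\<And>u v. u \<in> ?V \<Longrightarrow> v \<in> ?V \<Longrightarrow> (u, v) \<in> D\<^sup>* \<or> (v, u) \<in> D\<^sup>*"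
      show ?thesis
        by (rule bipartite_orientation_coloring[OF wf_digraph sym_arcs subset_trans[OF D(1) H(1)] D(2,3)])
          blast+
    qed
  qed
  then obtain c where c: "proper_connected G c" "range c \<subseteq> {0, 1}" by blast
  have lower: "2 \<le> card (c' ` edges G)" if "proper_connected G c'" for c'
    using two_le_colors_if_noncomplete[OF assms(1) _ that] assms(3,4) by simp
  have "c ` edges G \<subseteq> {0, 1}" by (rule subset_trans[OF image_mono[OF subset_UNIV] c(2)])
  then have "card (c ` edges G) \<le> card {0, 1 :: nat}" by (intro card_mono) simp_all
  then have "card (c ` edges G) = 2" using lower[OF c(1)] by simp
  then have "\<exists>c. proper_connected G c \<and> card (c ` edges G) = 2" using c(1) by blast
  then show ?thesis
    unfolding proper_connection_number_def by (rule Least_equality) (use lower in blast)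
qed

end
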